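(* Fix a diffusion time $t$ and $\square\in\{\nu,\omega\}$. Let $\varphi_{\square;t}(x\mid O)$ and $\psi_{\square;t}(x\mid O)$ be two equivariant descriptor fields (EDFs), and let $\otimes^{(\rightarrow1)}_{\square;t}$ be an equivariant tensor product mapping pairs of descriptors to a type-$1$ vector in $\mathbb{R}^3$. For $g=(p,R)\in SE(3)$, $x\in\mathbb{R}^3$ and point clouds $O_s,O_e\in\mathcal{O}$ define $$\widetilde{s}_{\square;t}(g,x\mid O_s,O_e)=\psi_{\square;t}(x\mid O_e)\;\otimes^{(\rightarrow1)}_{\square;t}\;\mathbf{D}(R^{-1})\,\varphi_{\square;t}(g\,x\mid O_s).$$ Then for all $\Delta g=(\Delta p,\Delta R)\in SE(3)$, $g\in SE(3)$, $x\in\mathbb{R}^3$, $O_s,O_e\in\mathcal{O}$, $$\widetilde{s}_{\square;t}(\Delta g\,g,x\mid\Delta g\cdot O_s,O_e)=\widetilde{s}_{\square;t}(g,x\mid O_s,O_e),$$ $$\widetilde{s}_{\square;t}(g\,\Delta g^{-1},\Delta g\,x\mid O_s,\Delta g\cdot O_e)=\Delta R\;\widetilde{s}_{\square;t}(g,x\mid O_s,O_e).$$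
   Context: $\mathcal{O}$ is the set of point clouds in $\mathbb{R}^3$, on which $SE(3)$ acts from the left by rigid motion of the points, written $\Delta g\cdot O$. Elements of $SE(3)$ are written $g=(p,R)$, acting on $x\in\mathbb{R}^3$ by $g\,x=Rx+p$. $\mathbf{D}_l(R)\in\mathbb{R}^{(2l+1)\times(2l+1)}$ denotes the real Wigner D-matrix of degree $l$, an irreducible representation of $SO(3)$; the basis is chosen so that $\mathbf{D}_1(R)=R$. Vectors transforming under $\mathbf{D}_l$ are called type-$l$ vectors. An equivariant descriptor field (EDF) is a vector field $\varphi(x\mid O)=\bigoplus_{n=1}^N\varphi^{(n)}(x\mid O)$ with $\varphi^{(n)}:\mathbb{R}^3\times\mathcal{O}\to\mathbb{R}^{2l_n+1}$ satisfying, for all $\Delta g=(\Delta p,\Delta R)\in SE(3)$, $x\in\mathbb{R}^3$, $O\in\mathcal{O}$, $$\varphi(\Delta g\,x\mid\Delta g\cdot O)=\mathbf{D}(\Delta R)\,\varphi(x\mid O),$$ where $\mathbf{D}(R)$ is the block-diagonal representation with blocks $\mathbf{D}_{l_1}(R),\dots,\mathbf{D}_{l_N}(R)$. The symbol $\mathbf{D}$ denotes the representation of this form acting on the descriptor space in question. An equivariant tensor product $\otimes^{(\rightarrow1)}$ (built from Clebsch–Gordan coefficients) is a bilinear map from pairs of descriptors to $\mathbb{R}^3$ such that $[\mathbf{D}(R)v]\otimes^{(\rightarrow1)}[\mathbf{D}(R)w]=\mathbf{D}_1(R)\left[v\otimes^{(\rightarrow1)}w\right]$ for all $R\in SO(3)$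 and all descriptors $v,w$. *)

theory Defs
  imports "HOL-Analysis.Analysis" "Jordan_Normal_Form.Matrix"
begin

(* Points and rotations of 3-space use real^3 and real^3^3.  Descriptors, whose dimension depends
   on a list of degrees, use the carrier-based vectors and matrices of Jordan_Normal_Form.  The
   two libraries share the symbols disabled here; below, $ is always indexing in real^3. *)
no_notation Matrix.vec_index (infixl \<open>$\<close> 100)
no_notation Matrix.scalar_prod (infix \<open>\<bullet>\<close> 70)

type_synonym point = "real^3"
type_synonym cloud = "point set"
type_synonym motion = "point \<times> (real^3^3)"

definition SO3 :: "(real^3^3) set" where
  "SO3 = {R. orthogonal_matrix R \<and> Determinants.det R = 1}"

definition SE3 :: "motion set" where
  "SE3 = {(p, R). R \<in> SO3}"

definition se3_act :: "motion \<Rightarrow> point \<Rightarrow> point" where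
  "se3_act g x = snd g *v x + fst g"

definition se3_mult :: "motion \<Rightarrow> motion \<Rightarrow> motion" where
  "se3_mult g h = (snd g *v fst h + fst g, snd g ** snd h)"

definition se3_inv :: "motion \<Rightarrow> motion" where
  "se3_inv g = (- (matrix_inv (snd g) *v fst g), matrix_inv (snd g))"

definition point_clouds :: "cloud set" where
  "point_clouds = {C. finite C}"

definition cloud_act :: "motion \<Rightarrow> cloud \<Rightarrow> cloud" where
  "cloud_act g C = se3_act g ` C"

(* The components of x :: real^3 are x $ 1, x $ 2, x $ 3; Jordan_Normal_Form counts from 0. *)
definition vec_of_point :: "real^3 \<Rightarrow> real Matrix.vec" where
  "vec_of_point x = Matrix.vec 3 (\<lambda>i. x $ of_nat (i + 1))"

definition mat_of_rotation :: "real^3^3 \<Rightarrow> real Matrix.mat" where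
  "mat_of_rotation R = Matrix.mat 3 3 (\<lambda>(i, j). R $ of_nat (i + 1) $ of_nat (j + 1))"

definition laplacian :: "(real^3 \<Rightarrow> real) \<Rightarrow> real^3 \<Rightarrow> real" where
  "laplacian f x = (\<Sum>k\<in>UNIV. (deriv ^^ 2) (\<lambda>s. f (x + s *\<^sub>R axis k 1)) 0)"

(* Homogeneous harmonic polynomials of degree l: the span of the real solid spherical harmonics
   of degree l, of dimension 2l+1. *)
definition solid_harmonics :: "nat \<Rightarrow> (real^3 \<Rightarrow> real) set" where
  "solid_harmonics l = {f. real_polynomial_function f
     \<and> (\<forall>c x. f (c *\<^sub>R x) = c ^ l * f x) \<and> (\<forall>x. laplacian f x = 0)}"

(* The 2l+1 components of Y form a basis of the solid harmonics of degree l: every such harmonic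
   is a linear combination of them for exactly one coefficient vector. *)
definition harmonic_basis :: "nat \<Rightarrow> (real^3 \<Rightarrow> real Matrix.vec) \<Rightarrow> bool" where
  "harmonic_basis l Y \<longleftrightarrow> (\<forall>x. Y x \<in> carrier_vec (2 * l + 1))
     \<and> bij_betw (\<lambda>c x. Matrix.scalar_prod c (Y x)) (carrier_vec (2 * l + 1)) (solid_harmonics l)"

(* D l R is the matrix by which the rotation R acts on a real spherical harmonic basis of
   degree l.  As usual the bases are a matter of convention; they are subject only to D 1 R = R. *)
definition real_wigner_D :: "(nat \<Rightarrow> real^3^3 \<Rightarrow> real Matrix.mat) \<Rightarrow> bool" where
  "real_wigner_D D \<longleftrightarrow>
     (\<forall>l. \<exists>Y. harmonic_basis l Y \<and>
        (\<forall>R\<in>SO3. D l R \<in> carrier_mat (2 * l + 1) (2 * l + 1) \<and>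
           (\<forall>x. Y (R *v x) = D l R *\<^sub>v Y x))) \<and>
     (\<forall>R\<in>SO3. D 1 R = mat_of_rotation R)"

(* A list of degrees [l_1, ..., l_N] determines the descriptor space (the direct sum of the
   type-l_n vectors) and the block-diagonal representation on it. *)
definition descriptors :: "nat list \<Rightarrow> real Matrix.vec set" where
  "descriptors ls = carrier_vec (\<Sum>l\<leftarrow>ls. 2 * l + 1)"

definition desc_rep ::
  "(nat \<Rightarrow> real^3^3 \<Rightarrow> real Matrix.mat) \<Rightarrow> nat list \<Rightarrow> real^3^3 \<Rightarrow> real Matrix.mat" where
  "desc_rep D ls R = diag_block_mat (map (\<lambda>l. D l R) ls)"

definition EDF ::
  "(nat \<Rightarrow> real^3^3 \<Rightarrow> real Matrix.mat) \<Rightarrow> nat list \<Rightarrow> (point \<Rightarrow> cloud \<Rightarrow> real Matrix.vec) \<Rightarrow> bool"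
  where
  "EDF D ls \<phi> \<longleftrightarrow>
     (\<forall>x. \<forall>C\<in>point_clouds. \<phi> x C \<in> descriptors ls) \<and>
     (\<forall>h\<in>SE3. \<forall>x. \<forall>C\<in>point_clouds.
        \<phi> (se3_act h x) (cloud_act h C) = desc_rep D ls (snd h) *\<^sub>v \<phi> x C)"

definition equivariant_tensor_product ::
  "(nat \<Rightarrow> real^3^3 \<Rightarrow> real Matrix.mat) \<Rightarrow> nat list \<Rightarrow> nat list \<Rightarrow>
   (real Matrix.vec \<Rightarrow> real Matrix.vec \<Rightarrow> real^3) \<Rightarrow> bool" where
  "equivariant_tensor_product D ls ms tp \<longleftrightarrow>
     (\<forall>v\<in>descriptors ls. \<forall>v'\<in>descriptors ls. \<forall>w\<in>descriptors ms.
        tp (v + v') w = tp v w + tp v' w) \<and>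
     (\<forall>v\<in>descriptors ls. \<forall>w\<in>descriptors ms. \<forall>w'\<in>descriptors ms.
        tp v (w + w') = tp v w + tp v w') \<and>
     (\<forall>a. \<forall>v\<in>descriptors ls. \<forall>w\<in>descriptors ms.
        tp (a \<cdot>\<^sub>v v) w = a *\<^sub>R tp v w \<and> tp v (a \<cdot>\<^sub>v w) = a *\<^sub>R tp v w) \<and>
     (\<forall>R\<in>SO3. \<forall>v\<in>descriptors ls. \<forall>w\<in>descriptors ms.
        vec_of_point (tp (desc_rep D ls R *\<^sub>v v) (desc_rep D ms R *\<^sub>v w))
          = D 1 R *\<^sub>v vec_of_point (tp v w))"

(* ms is the list of degrees of the descriptors phi. *)
definition score_field ::
  "(nat \<Rightarrow> real^3^3 \<Rightarrow> real Matrix.mat) \<Rightarrow> nat list \<Rightarrow>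
   (point \<Rightarrow> cloud \<Rightarrow> real Matrix.vec) \<Rightarrow> (point \<Rightarrow> cloud \<Rightarrow> real Matrix.vec) \<Rightarrow>
   (real Matrix.vec \<Rightarrow> real Matrix.vec \<Rightarrow> real^3) \<Rightarrow>
   motion \<Rightarrow> point \<Rightarrow> cloud \<Rightarrow> cloud \<Rightarrow> real^3" where
  "score_field D ms \<phi> \<psi> tp g x Os Oe =
     tp (\<psi> x Oe) (desc_rep D ms (matrix_inv (snd g)) *\<^sub>v \<phi> (se3_act g x) Os)"

(* The translational and the rotational part of the score. *)
datatype score_part = Nu | Omega

end

theory Submission
  imports Defs
begin

text \<open>Both identities reduce to the homomorphism property of the representation on descriptors.
  The Wigner matrices are specified only through Y(R x) = D(R) Y(x) for a harmonic basis Y. The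
  components of Y are linearly independent as functions, so a matrix is determined by its action on
  the values of Y. Comparing Y(R S x) with D(R) D(S) Y(x) gives D(R S) = D(R) D(S), and this
  passes to the block-diagonal sums.\<close>

section \<open>Rotations, their inverses and rigid motions\<close>

lemma SO3_D:
  assumes "R \<in> SO3"
  shows "Finite_Cartesian_Product.transpose R ** R = Finite_Cartesian_Product.mat 1"
    and "R ** Finite_Cartesian_Product.transpose R = Finite_Cartesian_Product.mat 1"
  using assms by (auto simp: SO3_def orthogonal_matrix_def)

lemma SO3_mult: "R \<in> SO3 \<Longrightarrow> S \<in> SO3 \<Longrightarrow> R ** S \<in> SO3"
  by (simp add: SO3_def orthogonal_matrix_mul Determinants.det_mul)

text \<open>A one-sided inverse of a square matrix is two-sided, so the choice defining
  \<open>matrix_inv\<close> ranges over a nonempty set; cancelling \<open>A\<close> from the left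
  then leaves only \<open>B\<close>.\<close>

lemma matrix_inv_eqI:
  fixes A B :: "real^'n^'n"
  assumes "A ** B = Finite_Cartesian_Product.mat 1"
  shows "matrix_inv A = B"
proof -
  have "B ** A = Finite_Cartesian_Product.mat 1"
    using assms matrix_left_right_inverse by blast
  then have "A ** matrix_inv A = Finite_Cartesian_Product.mat 1"
    unfolding matrix_inv_def using someI_ex assms
    by (metis (mono_tags, lifting))
  then have "B ** (A ** matrix_inv A) = B"
    by simp
  then show ?thesis
    by (simp add: matrix_mul_assoc \<open>B ** A = Finite_Cartesian_Product.mat 1\<close>)
qed

lemma matrix_inv_SO3:
  assumes "R \<in> SO3"
  shows "matrix_inv R = Finite_Cartesian_Product.transpose R"
  using assms by (intro matrix_inv_eqI SO3_D)

lemma SO3_matrix_inv: "R \<in> SO3 \<Longrightarrow> matrix_inv R \<in> SO3"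
  by (simp add: matrix_inv_SO3) (simp add: SO3_def Determinants.det_transpose)

lemma SO3_inverse:
  assumes "R \<in> SO3"
  shows "matrix_inv R ** R = Finite_Cartesian_Product.mat 1"
    and "R ** matrix_inv R = Finite_Cartesian_Product.mat 1"
  using assms by (simp_all add: matrix_inv_SO3 SO3_D)

lemma matrix_inv_inv_SO3: "R \<in> SO3 \<Longrightarrow> matrix_inv (matrix_inv R) = R"
  by (intro matrix_inv_eqI SO3_inverse)

lemma matrix_inv_mult_SO3:
  assumes "R \<in> SO3" "S \<in> SO3"
  shows "matrix_inv (R ** S) = matrix_inv S ** matrix_inv R"
  using assms
  by (simp add: matrix_inv_SO3 SO3_mult matrix_transpose_mul)

lemma SE3_snd: "g \<in> SE3 \<Longrightarrow> snd g \<in> SO3"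
  by (auto simp: SE3_def)

lemma se3_act_mult: "se3_act (se3_mult g h) x = se3_act g (se3_act h x)"
  by (simp add: se3_act_def se3_mult_def matrix_vector_mul_assoc matrix_vector_right_distrib)

lemma se3_act_inv:
  assumes "h \<in> SE3"
  shows "se3_act (se3_inv h) (se3_act h x) = x"
  using SO3_inverse(1)[OF SE3_snd[OF assms]]
  by (simp add: se3_act_def se3_inv_def matrix_vector_right_distrib matrix_vector_mul_assoc)

section \<open>Passage between \<open>real^3\<close> and carrier-based vectors\<close>

lemma UNIV_3_of_nat: "\<exists>n<3. (k :: 3) = of_nat (n + 1)"
proof -
  \<comment> \<open>In the type \<open>3\<close> the numeral 3 equals 0, so the shifted index
    \<open>n + 1\<close> still meets each of the three elements once as \<open>n\<close> runs
    through 0, 1, 2.\<close>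
  have "(1::3) = of_nat (0 + 1)" "(2::3) = of_nat (1 + 1)" "(3::3) = of_nat (2 + 1)"
    by simp_all
  moreover have "(0::nat) < 3" "(1::nat) < 3" "(2::nat) < 3"
    by simp_all
  ultimately show ?thesis
    using exhaust_3[of k] by blast
qed

text \<open>Equivariance of the tensor product is stated after applying \<open>vec_of_point\<close>;
  injectivity carries the resulting equation back to \<open>real^3\<close>.\<close>

lemma vec_of_point_inject:
  assumes "vec_of_point x = vec_of_point y"
  shows "x = y"
proof (rule Finite_Cartesian_Product.vec_eq_iff[THEN iffD2], rule allI)
  fix k :: 3
  obtain n where n: "n < 3" "k = of_nat (n + 1)"
    using UNIV_3_of_nat by blast
  then have "Matrix.vec_index (vec_of_point x) n = Matrix.vec_index (vec_of_point y) n"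
    using assms by simp
  then show "x $ k = y $ k"
    using n by (simp add: vec_of_point_def)
qed

lemma mat_of_rotation_mult_vec:
  "mat_of_rotation R *\<^sub>v vec_of_point x = vec_of_point (R *v x)"
proof (rule Matrix.eq_vecI)
  fix i assume "i < dim_vec (vec_of_point (R *v x))"
  then have i: "i < 3"
    by (simp add: vec_of_point_def)
  then show "Matrix.vec_index (mat_of_rotation R *\<^sub>v vec_of_point x) i
      = Matrix.vec_index (vec_of_point (R *v x)) i"
    by (simp add: vec_of_point_def mat_of_rotation_def Matrix.scalar_prod_def
        matrix_vector_mult_def sum_3 numeral_3_eq_3)
qed (simp add: vec_of_point_def mat_of_rotation_def)

section \<open>Wigner matrices as a representation\<close>

lemma harmonic_basis_mat_eqI:
  assumes Y: "harmonic_basis l Y"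
    and A: "A \<in> carrier_mat (2 * l + 1) (2 * l + 1)"
    and B: "B \<in> carrier_mat (2 * l + 1) (2 * l + 1)"
    and eq: "\<And>x. A *\<^sub>v Y x = B *\<^sub>v Y x"
  shows "A = B"
proof (rule Matrix.eq_rowI)
  fix i assume "i < dim_row B"
  then have i: "i < 2 * l + 1"
    using B by simp
  \<comment> \<open>Linear independence of the components of \<open>Y\<close>: distinct coefficient
    vectors define distinct functions. Row \<open>i\<close> of a matrix is such a vector, since
    component \<open>i\<close> of \<open>A *\<^sub>v Y x\<close> is its pairing with
    \<open>Y x\<close>.\<close>
  have "inj_on (\<lambda>c x. Matrix.scalar_prod c (Y x)) (carrier_vec (2 * l + 1))"
    using Y by (simp add: harmonic_basis_def bij_betw_def)
  moreover have "(\<lambda>x. Matrix.scalar_prod (Matrix.row A i) (Y x))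
      = (\<lambda>x. Matrix.scalar_prod (Matrix.row B i) (Y x))"
  proof
    fix x
    have "Matrix.vec_index (A *\<^sub>v Y x) i = Matrix.vec_index (B *\<^sub>v Y x) i"
      by (simp only: eq)
    then show "Matrix.scalar_prod (Matrix.row A i) (Y x)
        = Matrix.scalar_prod (Matrix.row B i) (Y x)"
      using A B i by simp
  qed
  moreover have "Matrix.row A i \<in> carrier_vec (2 * l + 1)" "Matrix.row B i \<in> carrier_vec (2 * l + 1)"
    using A B i by auto
  ultimately show "Matrix.row A i = Matrix.row B i"
    by (auto dest: inj_onD)
qed (use A B in auto)

lemma wigner_carrier:
  assumes "real_wigner_D D" "R \<in> SO3"
  shows "D l R \<in> carrier_mat (2 * l + 1) (2 * l + 1)"
  using assms unfolding real_wigner_D_def by blast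

lemma wigner_mult:
  assumes D: "real_wigner_D D" and R: "R \<in> SO3" and S: "S \<in> SO3"
  shows "D l (R ** S) = D l R * D l S"
proof -
  \<comment> \<open>A single basis \<open>Y\<close> of degree \<open>l\<close> serves every
    rotation, so the matrices of \<open>R\<close>, \<open>S\<close> and \<open>R ** S\<close> can be
    compared on it.\<close>
  obtain Y where Y: "harmonic_basis l Y"
    and YD: "\<And>R x. R \<in> SO3 \<Longrightarrow> Y (R *v x) = D l R *\<^sub>v Y x"
    using D unfolding real_wigner_D_def by blast
  note carr = wigner_carrier[OF D, of _ l]
  show ?thesis
  proof (rule harmonic_basis_mat_eqI[OF Y])
    fix x
    have Yx: "Y x \<in> carrier_vec (2 * l + 1)"
      using Y by (simp add: harmonic_basis_def)
    have "D l (R ** S) *\<^sub>v Y x = Y (R *v (S *v x))"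
      by (simp add: YD[OF SO3_mult[OF R S], symmetric] matrix_vector_mul_assoc)
    also have "\<dots> = D l R *\<^sub>v (D l S *\<^sub>v Y x)"
      by (simp only: YD R S)
    also have "\<dots> = (D l R * D l S) *\<^sub>v Y x"
      by (rule Matrix.assoc_mult_mat_vec[OF carr[OF R] carr[OF S] Yx, symmetric])
    finally show "D l (R ** S) *\<^sub>v Y x = (D l R * D l S) *\<^sub>v Y x" .
  qed (use carr[OF SO3_mult[OF R S]] mult_carrier_mat[OF carr[OF R] carr[OF S]] in simp_all)
qed

section \<open>The block-diagonal representation on descriptors\<close>

lemma desc_rep_carrier:
  assumes "real_wigner_D D" "R \<in> SO3"
  shows "desc_rep D ls R \<in> carrier_mat (\<Sum>l\<leftarrow>ls. 2 * l + 1) (\<Sum>l\<leftarrow>ls. 2 * l + 1)"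
proof -
  have "map (\<lambda>l. dim_row (D l R)) ls = map (\<lambda>l. 2 * l + 1) ls"
    and "map (\<lambda>l. dim_col (D l R)) ls = map (\<lambda>l. 2 * l + 1) ls"
    using wigner_carrier[OF assms] by auto
  then show ?thesis
    unfolding desc_rep_def carrier_mat_def
    by (simp add: dim_diag_block_mat o_def cong: map_cong)
qed

text \<open>Peels off the first block, with the zero blocks sized by the degrees alone, so that the
  decompositions for different rotations have matching shapes and multiply blockwise.\<close>

lemma desc_rep_Cons:
  assumes "real_wigner_D D" "R \<in> SO3"
  shows "desc_rep D (l # ls) R = four_block_mat (D l R)
      (0\<^sub>m (2 * l + 1) (\<Sum>l\<leftarrow>ls. 2 * l + 1)) (0\<^sub>m (\<Sum>l\<leftarrow>ls. 2 * l + 1) (2 * l + 1)) (desc_rep D ls R)"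
  using wigner_carrier[OF assms, of l] desc_rep_carrier[OF assms, of ls]
  by (simp add: desc_rep_def Let_def)

lemma desc_rep_mult:
  assumes D: "real_wigner_D D" and R: "R \<in> SO3" and S: "S \<in> SO3"
  shows "desc_rep D ls (R ** S) = desc_rep D ls R * desc_rep D ls S"
proof (induction ls)
  case Nil
  show ?case
    by (simp add: desc_rep_def)
next
  case (Cons l ls)
  let ?n = "2 * l + 1" and ?m = "\<Sum>l\<leftarrow>ls. 2 * l + 1"
  note c = wigner_carrier[OF D R, of l] wigner_carrier[OF D S, of l]
    desc_rep_carrier[OF D R, of ls] desc_rep_carrier[OF D S, of ls]
  have "desc_rep D (l # ls) R * desc_rep D (l # ls) S
      = four_block_mat (D l R * D l S) (0\<^sub>m ?n ?m) (0\<^sub>m ?m ?n) (desc_rep D ls R * desc_rep D ls S)"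
    unfolding desc_rep_Cons[OF D R] desc_rep_Cons[OF D S]
    \<comment> \<open>Every product involving a zero block vanishes, which leaves only the two
      products along the diagonal.\<close>
    by (subst mult_four_block_mat[OF c(1) _ _ c(3) c(2) _ _ c(4)]) (use c in auto)
  also have "\<dots> = desc_rep D (l # ls) (R ** S)"
    by (simp only: desc_rep_Cons[OF D SO3_mult[OF R S]] wigner_mult[OF D R S] Cons.IH)
  finally show ?case ..
qed

lemma desc_rep_mult_vec:
  assumes "real_wigner_D D" "R \<in> SO3" "S \<in> SO3" "v \<in> descriptors ls"
  shows "desc_rep D ls R *\<^sub>v (desc_rep D ls S *\<^sub>v v) = desc_rep D ls (R ** S) *\<^sub>v v"
  using assms(4) desc_rep_carrier[OF assms(1,2)] desc_rep_carrier[OF assms(1,3)]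
  unfolding desc_rep_mult[OF assms(1-3)] descriptors_def
  by (intro Matrix.assoc_mult_mat_vec[symmetric])

lemma desc_rep_descriptors:
  assumes "real_wigner_D D" "R \<in> SO3" "v \<in> descriptors ls"
  shows "desc_rep D ls R *\<^sub>v v \<in> descriptors ls"
  using assms desc_rep_carrier[of D R ls] by (auto simp: descriptors_def)

text \<open>The target is of type 1, where the convention \<open>D 1 R = mat_of_rotation R\<close>
  makes the Wigner matrix the rotation itself. This is the source of the factor \<open>snd h\<close>
  in the second identity.\<close>

lemma equivariant_tensor_product_rotate:
  assumes "real_wigner_D D" "equivariant_tensor_product D ls ms tp"
    and "R \<in> SO3" "v \<in> descriptors ls" "w \<in> descriptors ms"
  shows "tp (desc_rep D ls R *\<^sub>v v) (desc_rep D ms R *\<^sub>v w) = R *v tp v w"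
proof (rule vec_of_point_inject)
  have "D 1 R = mat_of_rotation R"
    using assms(1,3) by (auto simp: real_wigner_D_def)
  then show "vec_of_point (tp (desc_rep D ls R *\<^sub>v v) (desc_rep D ms R *\<^sub>v w))
      = vec_of_point (R *v tp v w)"
    using assms(2-) by (simp add: equivariant_tensor_product_def mat_of_rotation_mult_vec)
qed

theorem proposition6:
  fixes D :: "nat \<Rightarrow> real^3^3 \<Rightarrow> real Matrix.mat"
    and sq :: score_part and t :: real
    and ls ms :: "nat list"
    and \<phi> \<psi> :: "score_part \<Rightarrow> real \<Rightarrow> point \<Rightarrow> cloud \<Rightarrow> real Matrix.vec"
    and tp :: "score_part \<Rightarrow> real \<Rightarrow> real Matrix.vec \<Rightarrow> real Matrix.vec \<Rightarrow> real^3"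
    and h g :: motion and x :: point and Os Oe :: cloud
  assumes "real_wigner_D D"
    and "EDF D ms (\<phi> sq t)"
    and "EDF D ls (\<psi> sq t)"
    and "equivariant_tensor_product D ls ms (tp sq t)"
    and "h \<in> SE3" and "g \<in> SE3"
    and "Os \<in> point_clouds" and "Oe \<in> point_clouds"
  defines "s \<equiv> score_field D ms (\<phi> sq t) (\<psi> sq t) (tp sq t)"
  shows "s (se3_mult h g) x (cloud_act h Os) Oe = s g x Os Oe
    \<and> s (se3_mult g (se3_inv h)) (se3_act h x) Os (cloud_act h Oe) = snd h *v s g x Os Oe"
proof
  have h: "snd h \<in> SO3" and g: "snd g \<in> SO3"
    using assms(5,6) by (simp_all add: SE3_snd)
  note inv_h = SO3_matrix_inv[OF h] and inv_g = SO3_matrix_inv[OF g]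
  define v where "v = \<psi> sq t x Oe"
  define w where "w = \<phi> sq t (se3_act g x) Os"
  have v: "v \<in> descriptors ls" and w: "w \<in> descriptors ms"
    using assms(2,3,7,8) by (simp_all add: v_def w_def EDF_def)
  have s_g: "s g x Os Oe = tp sq t v (desc_rep D ms (matrix_inv (snd g)) *\<^sub>v w)"
    by (simp add: s_def score_field_def v_def w_def)

  \<comment> \<open>First identity: equivariance of \<open>\<phi>\<close> produces the factor for
    \<open>snd h\<close>, which the inverse of \<open>snd h ** snd g\<close> absorbs, leaving the
    inverse of \<open>snd g\<close>.\<close>
  have "\<phi> sq t (se3_act (se3_mult h g) x) (cloud_act h Os) = desc_rep D ms (snd h) *\<^sub>v w"
    using assms(2,5,7) by (simp add: se3_act_mult EDF_def w_def)
  moreover have "matrix_inv (snd h ** snd g) ** snd h = matrix_inv (snd g)"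
    by (simp add: matrix_inv_mult_SO3 h g matrix_mul_assoc[symmetric] SO3_inverse)
  ultimately show "s (se3_mult h g) x (cloud_act h Os) Oe = s g x Os Oe"
    unfolding s_g
    by (simp add: s_def score_field_def se3_mult_def v_def
        desc_rep_mult_vec[OF assms(1) SO3_matrix_inv[OF SO3_mult[OF h g]] h w])

  have "\<psi> sq t (se3_act h x) (cloud_act h Oe) = desc_rep D ls (snd h) *\<^sub>v v"
    using assms(3,5,8) by (simp add: EDF_def v_def)
  \<comment> \<open>The motions of \<open>x\<close> and of \<open>g\<close> cancel, so
    \<open>\<phi>\<close> is evaluated at the same point and cloud as before.\<close>
  moreover have "se3_act (se3_mult g (se3_inv h)) (se3_act h x) = se3_act g x"
    by (simp add: se3_act_mult se3_act_inv assms(5))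
  \<comment> \<open>Inversion reverses the order and puts \<open>snd h\<close> on the left.
    Splitting the representation there lets the same rotation act outermost on both arguments of the
    tensor product.\<close>
  moreover have "matrix_inv (snd (se3_mult g (se3_inv h))) = snd h ** matrix_inv (snd g)"
    by (simp add: se3_mult_def se3_inv_def matrix_inv_mult_SO3 g inv_h matrix_inv_inv_SO3 h)
  ultimately have "s (se3_mult g (se3_inv h)) (se3_act h x) Os (cloud_act h Oe)
      = tp sq t (desc_rep D ls (snd h) *\<^sub>v v)
          (desc_rep D ms (snd h) *\<^sub>v (desc_rep D ms (matrix_inv (snd g)) *\<^sub>v w))"
    by (simp add: s_def score_field_def w_def[symmetric] desc_rep_mult_vec[OF assms(1) h inv_g w])
  also have "\<dots> = snd h *v s g x Os Oe"
    unfolding s_g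
    by (rule equivariant_tensor_product_rotate[OF assms(1,4) h v
          desc_rep_descriptors[OF assms(1) inv_g w]])
  finally show "s (se3_mult g (se3_inv h)) (se3_act h x) Os (cloud_act h Oe)
      = snd h *v s g x Os Oe" .
qed

end
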